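(* Let $E$ be a finite set, $k\ge0$ an integer and $\mathcal{F}\subseteq2^E$. Then $(E,\mathcal{F})$ is a $k$-truncated antimatroid if and only if there exists a $(k-1)$-isotone operator $\Psi$ on $E$ such that $\mathcal{F}=\mathcal{F}(\Psi)$.
   Context: A set system $(E,\mathcal{A})$ with $\mathcal{A}\ne\emptyset$ is an antimatroid if (A1) for each nonempty $X\in\mathcal{A}$ there is $x\in X$ with $X\setminus\{x\}\in\mathcal{A}$, and (A2) for all $X,Y\in\mathcal{A}$ with $X\not\subseteq Y$ there is $x\in X\setminus Y$ with $Y\cup\{x\}\in\mathcal{A}$. $(E,\mathcal{F})$ is a $k$-truncated antimatroid if there is an antimatroid $(E,\mathcal{A})$ with $\mathcal{F}=\{X\in\mathcal{A}:|X|\le k\}$. A $(k-1)$-isotone operator is a map $\Psi:2^E\to2^E$ with $\Psi(X)\subseteq E\setminus X$ for all $X$, such that $\Psi(X)\cap(E\setminus Y)\subseteq\Psi(Y)$ whenever $X\subseteq Y\subseteq E$ and $|Y|\le k-1$, and $\Psi(X)=\emptyset$ whenever $|X|\ge k$. $\mathcal{F}(\Psi)$ is the family of all $X\subseteq E$ for which there exist $x_1,\dots,x_m$ ($m\ge0$) with $X=\{x_1,\dots,x_m\}$ and $x_i\in\Psi(\{x_1,\dots,x_{i-1}\})$ for $1\le i\le m$. *)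

theory Defs
  imports Main
begin

definition antimatroid :: "'a set \<Rightarrow> 'a set set \<Rightarrow> bool" where
  "antimatroid E \<A> \<longleftrightarrow>
     \<A> \<subseteq> Pow E \<and> \<A> \<noteq> {} \<and>
     (\<forall>X\<in>\<A>. X \<noteq> {} \<longrightarrow> (\<exists>x\<in>X. X - {x} \<in> \<A>)) \<and>
     (\<forall>X\<in>\<A>. \<forall>Y\<in>\<A>. \<not> X \<subseteq> Y \<longrightarrow> (\<exists>x\<in>X - Y. Y \<union> {x} \<in> \<A>))"

definition truncated_antimatroid :: "nat \<Rightarrow> 'a set \<Rightarrow> 'a set set \<Rightarrow> bool" where
  "truncated_antimatroid k E \<F> \<longleftrightarrow>
     (\<exists>\<A>. antimatroid E \<A> \<and> \<F> = {X \<in> \<A>. card X \<le> k})"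

text \<open>The index \<open>j\<close> is an integer because the \<open>(k - 1)\<close>-isotone operators are also
  needed for \<open>k = 0\<close>.  A map from subsets of \<open>E\<close> to subsets of \<open>E\<close> is represented by a total
  function whose values outside the subsets of \<open>E\<close> are unconstrained and never used.\<close>

definition isotone_operator :: "int \<Rightarrow> 'a set \<Rightarrow> ('a set \<Rightarrow> 'a set) \<Rightarrow> bool" where
  "isotone_operator j E \<Psi> \<longleftrightarrow>
     (\<forall>X. X \<subseteq> E \<longrightarrow> \<Psi> X \<subseteq> E - X) \<and>
     (\<forall>X Y. X \<subseteq> Y \<longrightarrow> Y \<subseteq> E \<longrightarrow> int (card Y) \<le> j \<longrightarrow> \<Psi> X \<inter> (E - Y) \<subseteq> \<Psi> Y) \<and>
     (\<forall>X. X \<subseteq> E \<longrightarrow> int (card X) \<ge> j + 1 \<longrightarrow> \<Psi> X = {})"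

text \<open>The list \<open>xs\<close> is the sequence \<open>x\<^sub>1, \<dots>, x\<^sub>m\<close>, indexed from \<open>0\<close>.\<close>

definition operator_family :: "'a set \<Rightarrow> ('a set \<Rightarrow> 'a set) \<Rightarrow> 'a set set" where
  "operator_family E \<Psi> =
     {X. X \<subseteq> E \<and> (\<exists>xs. X = set xs \<and> (\<forall>i<length xs. xs ! i \<in> \<Psi> (set (take i xs))))}"

end

theory Submission
  imports Defs
begin

text \<open>
  Without a bound on cardinalities, isotone operators and antimatroids correspond to each other:
  the family of such an operator is an antimatroid, and an antimatroid is the family of the
  operator sending \<open>X\<close> to all \<open>x \<notin> X\<close> such that \<open>Z\<close> and \<open>Z \<union> {x}\<close> are members for some \<open>Z \<subseteq> X\<close>,
  since by (A2) such an \<open>x\<close> can be added to \<open>X\<close> itself whenever \<open>X\<close> is a member.  Emptying an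
  operator on the sets of size at least \<open>k\<close> truncates its family at \<open>k\<close>.  It remains to find, for
  a \<open>(k - 1)\<close>-isotone operator \<open>\<Psi>\<close>, an isotone operator agreeing with \<open>\<Psi>\<close> on the sets of size
  less than \<open>k\<close>; \<open>X \<mapsto> (\<Union>Z\<subseteq>X. \<Psi> Z) - X\<close> is one.
\<close>

definition avoiding_operator :: "'a set \<Rightarrow> ('a set \<Rightarrow> 'a set) \<Rightarrow> bool" where
  "avoiding_operator E \<Psi> \<longleftrightarrow> (\<forall>X\<subseteq>E. \<Psi> X \<subseteq> E - X)"

definition unbounded_isotone_operator :: "'a set \<Rightarrow> ('a set \<Rightarrow> 'a set) \<Rightarrow> bool" where
  "unbounded_isotone_operator E \<Psi> \<longleftrightarrow>
     avoiding_operator E \<Psi> \<and> (\<forall>X Y. X \<subseteq> Y \<longrightarrow> Y \<subseteq> E \<longrightarrow> \<Psi> X \<inter> (E - Y) \<subseteq> \<Psi> Y)"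

definition truncated_operator :: "nat \<Rightarrow> ('a set \<Rightarrow> 'a set) \<Rightarrow> 'a set \<Rightarrow> 'a set" where
  "truncated_operator k \<Psi> X = (if card X < k then \<Psi> X else {})"

definition isotone_hull :: "('a set \<Rightarrow> 'a set) \<Rightarrow> 'a set \<Rightarrow> 'a set" where
  "isotone_hull \<Psi> X = (\<Union>Z\<in>Pow X. \<Psi> Z) - X"

definition augmentation_operator :: "'a set \<Rightarrow> 'a set set \<Rightarrow> 'a set \<Rightarrow> 'a set" where
  "augmentation_operator E \<A> X = {x \<in> E - X. \<exists>Z\<subseteq>X. Z \<in> \<A> \<and> insert x Z \<in> \<A>}"

inductive feasible :: "('a set \<Rightarrow> 'a set) \<Rightarrow> 'a set \<Rightarrow> bool" for \<Psi> where
  empty: "feasible \<Psi> {}"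
| insert: "feasible \<Psi> X \<Longrightarrow> x \<in> \<Psi> X \<Longrightarrow> feasible \<Psi> (insert x X)"

lemma avoiding_operator_notin:
  "avoiding_operator E \<Psi> \<Longrightarrow> X \<subseteq> E \<Longrightarrow> x \<in> \<Psi> X \<Longrightarrow> x \<notin> X"
  by (auto simp: avoiding_operator_def)

lemma isotone_operator_iff_card_less:
  "isotone_operator (int k - 1) E \<Psi> \<longleftrightarrow>
     avoiding_operator E \<Psi> \<and>
     (\<forall>X Y. X \<subseteq> Y \<longrightarrow> Y \<subseteq> E \<longrightarrow> card Y < k \<longrightarrow> \<Psi> X \<inter> (E - Y) \<subseteq> \<Psi> Y) \<and>
     (\<forall>X\<subseteq>E. k \<le> card X \<longrightarrow> \<Psi> X = {})"
proof -
  have "int n \<le> int k - 1 \<longleftrightarrow> n < k" for n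
    by linarith
  then show ?thesis
    by (simp add: isotone_operator_def avoiding_operator_def)
qed

lemma isotone_operator_imp_avoiding:
  "isotone_operator (int k - 1) E \<Psi> \<Longrightarrow> avoiding_operator E \<Psi>"
  by (simp add: isotone_operator_iff_card_less)

lemma unbounded_isotone_operator_imp_avoiding:
  "unbounded_isotone_operator E \<Psi> \<Longrightarrow> avoiding_operator E \<Psi>"
  by (simp add: unbounded_isotone_operator_def)

lemma all_nth_take_snoc:
  "(\<forall>i<length (xs @ [x]). P ((xs @ [x]) ! i) (take i (xs @ [x]))) \<longleftrightarrow>
     (\<forall>i<length xs. P (xs ! i) (take i xs)) \<and> P x xs"
  by (auto simp: nth_append less_Suc_eq)

lemma feasible_iff_list:
  "feasible \<Psi> X \<longleftrightarrow> (\<exists>xs. X = set xs \<and> (\<forall>i<length xs. xs ! i \<in> \<Psi> (set (take i xs))))"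
    (is "_ \<longleftrightarrow> (\<exists>xs. X = set xs \<and> ?steps xs)")
proof
  assume "feasible \<Psi> X"
  then show "\<exists>xs. X = set xs \<and> ?steps xs"
  proof induction
    case empty
    show ?case
      by (intro exI[of _ "[]"]) simp
  next
    case (insert X x)
    then obtain xs where "X = set xs" "?steps xs"
      by blast
    with insert.hyps have "insert x X = set (xs @ [x]) \<and> ?steps (xs @ [x])"
      using all_nth_take_snoc[of xs x "\<lambda>y ys. y \<in> \<Psi> (set ys)"] by simp
    then show ?case ..
  qed
next
  have "feasible \<Psi> (set xs)" if "?steps xs" for xs
    using that
  proof (induction xs rule: rev_induct)
    case Nil
    show ?case
      by (simp add: feasible.empty)
  next
    case (snoc x xs)
    then have "?steps xs" "x \<in> \<Psi> (set xs)"
      using all_nth_take_snoc[of xs x "\<lambda>y ys. y \<in> \<Psi> (set ys)"] by blast+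
    then show ?case
      using snoc.IH by (simp add: feasible.insert)
  qed
  then show "\<exists>xs. X = set xs \<and> ?steps xs \<Longrightarrow> feasible \<Psi> X"
    by blast
qed

lemma operator_family_eq_feasible: "operator_family E \<Psi> = {X. X \<subseteq> E \<and> feasible \<Psi> X}"
  by (auto simp: operator_family_def feasible_iff_list)

lemma feasible_imp_finite: "feasible \<Psi> X \<Longrightarrow> finite X"
  by (induction rule: feasible.induct) auto

lemma feasible_cong_subsets:
  assumes "\<And>Z. Z \<subseteq> E \<Longrightarrow> \<Psi> Z = \<Phi> Z" and "X \<subseteq> E" and "feasible \<Psi> X"
  shows "feasible \<Phi> X"
  using assms(3,2)
proof induction
  case (insert X x)
  then show ?case
    using assms(1)[of X] by (auto intro: feasible.insert)
qed (rule feasible.empty)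

lemma operator_family_cong:
  assumes "\<And>X. X \<subseteq> E \<Longrightarrow> \<Psi> X = \<Phi> X"
  shows "operator_family E \<Psi> = operator_family E \<Phi>"
  using feasible_cong_subsets[of E \<Psi> \<Phi>] feasible_cong_subsets[of E \<Phi> \<Psi>] assms
  by (auto simp: operator_family_eq_feasible)

lemma feasible_remove:
  assumes "avoiding_operator E \<Psi>" and "X \<subseteq> E" and "X \<noteq> {}" and "feasible \<Psi> X"
  shows "\<exists>x\<in>X. feasible \<Psi> (X - {x})"
  using assms(4)
proof cases
  case (insert Z x)
  then have "x \<notin> Z"
    using assms(1,2) by (auto dest: avoiding_operator_notin)
  then show ?thesis
    using insert by auto
qed (use assms(3) in simp)

lemma feasible_augment:
  assumes "unbounded_isotone_operator E \<Psi>"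
    and "feasible \<Psi> X" and "feasible \<Psi> Y" and "X \<subseteq> E" and "Y \<subseteq> E" and "\<not> X \<subseteq> Y"
  shows "\<exists>x\<in>X - Y. feasible \<Psi> (insert x Y)"
  using assms(2,4,6)
proof induction
  case (insert X x)
  show ?case
  proof (cases "X \<subseteq> Y")
    case True
    then have "x \<in> E - Y"
      using insert.prems by blast
    moreover have "x \<in> \<Psi> Y"
      using assms(1,5) True insert.hyps \<open>x \<in> E - Y\<close>
      unfolding unbounded_isotone_operator_def by blast
    ultimately show ?thesis
      using assms(3) by (auto intro: feasible.insert)
  next
    case False
    then show ?thesis
      using insert by auto
  qed
qed simp

lemma antimatroid_operator_family:
  assumes "unbounded_isotone_operator E \<Psi>"
  shows "antimatroid E (operator_family E \<Psi>)"
  unfolding antimatroid_def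
proof (intro conjI ballI impI)
  have "{} \<in> operator_family E \<Psi>"
    by (simp add: operator_family_eq_feasible feasible.empty)
  then show "operator_family E \<Psi> \<noteq> {}"
    by blast
next
  fix X assume "X \<in> operator_family E \<Psi>" "X \<noteq> {}"
  then show "\<exists>x\<in>X. X - {x} \<in> operator_family E \<Psi>"
    using feasible_remove[OF unbounded_isotone_operator_imp_avoiding[OF assms], of X]
    by (auto simp: operator_family_eq_feasible)
next
  fix X Y assume "X \<in> operator_family E \<Psi>" "Y \<in> operator_family E \<Psi>" "\<not> X \<subseteq> Y"
  then show "\<exists>x\<in>X - Y. Y \<union> {x} \<in> operator_family E \<Psi>"
    using feasible_augment[OF assms, of X Y] by (auto simp: operator_family_eq_feasible)
qed (auto simp: operator_family_eq_feasible)

lemma feasible_truncated_operator_iff: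
  assumes "avoiding_operator E \<Psi>" and "X \<subseteq> E"
  shows "feasible (truncated_operator k \<Psi>) X \<longleftrightarrow> feasible \<Psi> X \<and> card X \<le> k"
proof
  assume "feasible (truncated_operator k \<Psi>) X"
  then show "feasible \<Psi> X \<and> card X \<le> k"
  proof induction
    case (insert X x)
    then have "card X < k" "x \<in> \<Psi> X"
      by (auto simp: truncated_operator_def split: if_splits)
    moreover have "card (insert x X) \<le> Suc (card X)"
      by (rule card_insert_le_m1) simp_all
    ultimately show ?case
      using insert.IH by (auto intro: feasible.insert)
  qed (simp add: feasible.empty)
next
  assume "feasible \<Psi> X \<and> card X \<le> k"
  then have "feasible \<Psi> X" "card X \<le> k"
    by simp_all
  then show "feasible (truncated_operator k \<Psi>) X"
    using assms(2)
  proof induction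
    case (insert X x)
    then have "x \<notin> X"
      using assms(1) by (auto dest: avoiding_operator_notin)
    then have "card X < k"
      using insert.prems feasible_imp_finite[OF insert.hyps(1)] by simp
    then show ?case
      using insert by (auto simp: truncated_operator_def intro!: feasible.insert)
  qed (simp add: feasible.empty)
qed

lemma operator_family_truncated_operator:
  assumes "avoiding_operator E \<Psi>"
  shows "operator_family E (truncated_operator k \<Psi>) = {X \<in> operator_family E \<Psi>. card X \<le> k}"
  using feasible_truncated_operator_iff[OF assms] by (auto simp: operator_family_eq_feasible)

lemma isotone_operator_truncated_operator:
  assumes "unbounded_isotone_operator E \<Psi>"
  shows "isotone_operator (int k - 1) E (truncated_operator k \<Psi>)"
  using assms
  by (simp add: isotone_operator_iff_card_less unbounded_isotone_operator_def
      avoiding_operator_def truncated_operator_def)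

lemma unbounded_isotone_operator_isotone_hull:
  assumes "avoiding_operator E \<Psi>"
  shows "unbounded_isotone_operator E (isotone_hull \<Psi>)"
proof -
  have "avoiding_operator E (isotone_hull \<Psi>)"
    using assms unfolding avoiding_operator_def isotone_hull_def by blast
  then show ?thesis
    by (auto simp: unbounded_isotone_operator_def isotone_hull_def)
qed

lemma truncated_operator_isotone_hull:
  assumes "isotone_operator (int k - 1) E \<Psi>" and "X \<subseteq> E"
  shows "truncated_operator k (isotone_hull \<Psi>) X = \<Psi> X"
proof (cases "card X < k")
  case True
  have avoiding: "avoiding_operator E \<Psi>"
    using assms(1) by (rule isotone_operator_imp_avoiding)
  have "isotone_hull \<Psi> X \<subseteq> \<Psi> X"
  proof
    fix x assume "x \<in> isotone_hull \<Psi> X"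
    then obtain Z where "Z \<subseteq> X" "x \<in> \<Psi> Z" "x \<notin> X"
      by (auto simp: isotone_hull_def)
    moreover have "\<Psi> Z \<inter> (E - X) \<subseteq> \<Psi> X"
      using assms \<open>Z \<subseteq> X\<close> True by (simp add: isotone_operator_iff_card_less)
    moreover have "\<Psi> Z \<subseteq> E - Z"
      using avoiding \<open>Z \<subseteq> X\<close> assms(2) by (simp add: avoiding_operator_def)
    ultimately show "x \<in> \<Psi> X"
      by blast
  qed
  moreover have "\<Psi> X \<subseteq> isotone_hull \<Psi> X"
    using avoiding_operator_notin[OF avoiding assms(2)] by (auto simp: isotone_hull_def)
  ultimately show ?thesis
    using True by (simp add: truncated_operator_def)
next
  case False
  then show ?thesis
    using assms by (simp add: truncated_operator_def isotone_operator_iff_card_less)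
qed

lemma operator_family_truncates_isotone_hull:
  assumes "isotone_operator (int k - 1) E \<Psi>"
  shows "operator_family E \<Psi> = {X \<in> operator_family E (isotone_hull \<Psi>). card X \<le> k}"
proof -
  have "operator_family E \<Psi> = operator_family E (truncated_operator k (isotone_hull \<Psi>))"
    using truncated_operator_isotone_hull[OF assms] by (intro operator_family_cong) simp
  also have "\<dots> = {X \<in> operator_family E (isotone_hull \<Psi>). card X \<le> k}"
    using assms
    by (intro operator_family_truncated_operator unbounded_isotone_operator_imp_avoiding
        unbounded_isotone_operator_isotone_hull isotone_operator_imp_avoiding)
  finally show ?thesis .
qed

lemma antimatroid_remove:
  "antimatroid E \<A> \<Longrightarrow> X \<in> \<A> \<Longrightarrow> X \<noteq> {} \<Longrightarrow> \<exists>x\<in>X. X - {x} \<in> \<A>"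
  by (simp add: antimatroid_def)

lemma antimatroid_augment:
  "antimatroid E \<A> \<Longrightarrow> X \<in> \<A> \<Longrightarrow> Y \<in> \<A> \<Longrightarrow> \<not> X \<subseteq> Y \<Longrightarrow> \<exists>x\<in>X - Y. insert x Y \<in> \<A>"
  by (simp add: antimatroid_def)

lemma antimatroid_induct [consumes 3, case_names empty insert]:
  assumes "antimatroid E \<A>" and "finite X" and "X \<in> \<A>"
    and empty: "{} \<in> \<A> \<Longrightarrow> P {}"
    and insert: "\<And>X x. X \<in> \<A> \<Longrightarrow> insert x X \<in> \<A> \<Longrightarrow> x \<notin> X \<Longrightarrow> P X \<Longrightarrow> P (insert x X)"
  shows "P X"
  using assms(2,3)
proof (induction X rule: finite_psubset_induct)
  case (psubset X)
  show ?case
  proof (cases "X = {}")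
    case False
    then obtain x where "x \<in> X" "X - {x} \<in> \<A>"
      using antimatroid_remove[OF assms(1) psubset.prems] by blast
    moreover from \<open>x \<in> X\<close> have "insert x (X - {x}) = X"
      by blast
    ultimately show ?thesis
      using psubset.IH[of "X - {x}"] psubset.prems insert[of "X - {x}" x] by auto
  qed (use empty psubset.prems in simp)
qed

lemma antimatroid_empty_mem:
  assumes "antimatroid E \<A>" and "finite E"
  shows "{} \<in> \<A>"
proof -
  obtain X where "X \<in> \<A>" "X \<subseteq> E"
    using assms(1) by (auto simp: antimatroid_def)
  then have "finite X"
    using assms(2) finite_subset by blast
  from assms(1) this \<open>X \<in> \<A>\<close> show ?thesis
    by (induction rule: antimatroid_induct)
qed

lemma unbounded_isotone_operator_augmentation_operator:
  "unbounded_isotone_operator E (augmentation_operator E \<A>)"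
  by (auto simp: unbounded_isotone_operator_def avoiding_operator_def augmentation_operator_def)

lemma feasible_augmentation_operator_imp_mem:
  assumes "antimatroid E \<A>" and "finite E" and "feasible (augmentation_operator E \<A>) X"
  shows "X \<in> \<A>"
  using assms(3)
proof induction
  case empty
  show ?case
    using assms(1,2) by (rule antimatroid_empty_mem)
next
  case (insert X x)
  then obtain Z where "Z \<subseteq> X" "insert x Z \<in> \<A>" "x \<notin> X"
    by (auto simp: augmentation_operator_def)
  then obtain y where "y \<in> insert x Z - X" "insert y X \<in> \<A>"
    using antimatroid_augment[OF assms(1) \<open>insert x Z \<in> \<A>\<close> insert.IH] by blast
  moreover have "insert x Z - X = {x}"
    using \<open>Z \<subseteq> X\<close> \<open>x \<notin> X\<close> by blast
  ultimately show ?case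
    by simp
qed

lemma operator_family_augmentation_operator:
  assumes "antimatroid E \<A>" and "finite E"
  shows "operator_family E (augmentation_operator E \<A>) = \<A>"
proof -
  have subset: "X \<subseteq> E" if "X \<in> \<A>" for X
    using assms(1) that by (auto simp: antimatroid_def)
  have "feasible (augmentation_operator E \<A>) X" if "X \<in> \<A>" for X
    using assms(1) finite_subset[OF subset[OF that] assms(2)] that
  proof (induction rule: antimatroid_induct)
    case (insert X x)
    then have "x \<in> augmentation_operator E \<A> X"
      using subset by (auto simp: augmentation_operator_def)
    with insert.IH show ?case
      by (rule feasible.insert)
  qed (rule feasible.empty)
  then show ?thesis
    using subset feasible_augmentation_operator_imp_mem[OF assms]
    by (auto simp: operator_family_eq_feasible)
qed

theorem theorem4:
  fixes E :: "'a set" and k :: nat and \<F> :: "'a set set"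
  assumes "finite E" and "\<F> \<subseteq> Pow E"
  shows "truncated_antimatroid k E \<F> \<longleftrightarrow>
    (\<exists>\<Psi>. isotone_operator (int k - 1) E \<Psi> \<and> \<F> = operator_family E \<Psi>)"
proof
  assume "truncated_antimatroid k E \<F>"
  then obtain \<A> where \<A>: "antimatroid E \<A>" "\<F> = {X \<in> \<A>. card X \<le> k}"
    unfolding truncated_antimatroid_def by blast
  let ?\<Phi> = "augmentation_operator E \<A>"
  have isotone: "unbounded_isotone_operator E ?\<Phi>"
    by (rule unbounded_isotone_operator_augmentation_operator)
  then have "\<F> = operator_family E (truncated_operator k ?\<Phi>)"
    using \<A> assms(1) by (simp add: unbounded_isotone_operator_imp_avoiding
        operator_family_truncated_operator operator_family_augmentation_operator)
  with isotone show "\<exists>\<Psi>. isotone_operator (int k - 1) E \<Psi> \<and> \<F> = operator_family E \<Psi>"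
    using isotone_operator_truncated_operator by blast
next
  assume "\<exists>\<Psi>. isotone_operator (int k - 1) E \<Psi> \<and> \<F> = operator_family E \<Psi>"
  then obtain \<Psi> where \<Psi>: "isotone_operator (int k - 1) E \<Psi>" "\<F> = operator_family E \<Psi>"
    by blast
  then have "antimatroid E (operator_family E (isotone_hull \<Psi>))"
    by (intro antimatroid_operator_family unbounded_isotone_operator_isotone_hull
        isotone_operator_imp_avoiding)
  then show "truncated_antimatroid k E \<F>"
    using operator_family_truncates_isotone_hull[OF \<Psi>(1)] \<Psi>(2)
    unfolding truncated_antimatroid_def by blast
qed

end
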